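(* For any $\mathbf{u}, \mathbf{v} \in \mathbf{B}$ and $t \in [0,1]$, $$\rho_{\mathbf{u}} \#_{t} \rho_{\mathbf{v}} = L_{1-t}(\mu) \left( \frac{\gamma_{\mathbf{u}}}{\gamma_{\mathbf{v}}} \right)^{t} \rho_{\mathbf{u}} + L_{t}(\mu) \left( \frac{\gamma_{\mathbf{v}}}{\gamma_{\mathbf{u}}} \right)^{1-t} \rho_{\mathbf{v}},$$ where $\mu = \gamma_{\mathbf{u}} (1 - \mathbf{u}^{T} \mathbf{v}) (1 \pm \Vert \mathbf{u} \oplus_{E} (- \mathbf{v}) \Vert)$.
   Context: $\mathbf{B}$ is the open unit ball of $\mathbb{R}^3$ with Euclidean norm $\Vert\cdot\Vert$. For $\mathbf{v} = (v_1, v_2, v_3)^T \in \mathbf{B}$, $\rho_{\mathbf{v}} = \frac{1}{2} \begin{pmatrix} 1 + v_{3} & v_{1} - i v_{2} \\ v_{1} + i v_{2} & 1 - v_{3} \end{pmatrix}$ (a positive definite matrix of trace 1) and $\gamma_{\mathbf{v}} = \frac{1}{\sqrt{1 - \Vert \mathbf{v} \Vert^2}}$ is the Lorentz factor. The Einstein addition is $\mathbf{u} \oplus_{E} \mathbf{v} = \frac{1}{1 + \mathbf{u}^{T} \mathbf{v}} \left\{ \mathbf{u} + \frac{1}{\gamma_{\mathbf{u}}} \mathbf{v} + \frac{\gamma_{\mathbf{u}}}{1 + \gamma_{\mathbf{u}}} (\mathbf{u}^{T} \mathbf{v}) \mathbf{u} \right\}$. For positive definite $A, B$, $A \#_{t}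 B := A^{1/2} (A^{-1/2} B A^{-1/2})^{t} A^{1/2}$. For $t \in [0,1]$ the function $L_t : (0,\infty) \to \mathbb{R}$ is $L_t(x) = \frac{x^{t} - x^{-t}}{x - x^{-1}}$ for $x \neq 1$ and $L_t(1) = t$.
   Formalization: The formula for μ is corrected to μ = γ_u γ_v (1 − uᵀv)(1 ± ‖u ⊕_E (−v)‖); as printed, without the factor γ_v, the identity fails, e.g. at u = 0, v = (0,0,3/5), t = 1/2. *)

theory Defs
  imports "HOL-Analysis.Analysis"
begin

definition conj_transpose :: "complex^'n^'m \<Rightarrow> complex^'m^'n" where
  "conj_transpose A = (\<chi> i j. cnj (A $ j $ i))"

definition unitary_matrix :: "complex^'n^'n \<Rightarrow> bool" where
  "unitary_matrix U \<longleftrightarrow> conj_transpose U ** U = mat 1 \<and> U ** conj_transpose U = mat 1"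

definition diag_matrix :: "('n \<Rightarrow> real) \<Rightarrow> complex^'n^'n" where
  "diag_matrix d = (\<chi> i j. if i = j then complex_of_real (d i) else 0)"

text \<open>
  Real powers of a positive definite matrix by functional calculus:
  if \<open>A = U diag(d) U*\<close> with \<open>U\<close> unitary and all \<open>d i > 0\<close>, then
  \<open>A\<^sup>t = U diag(d\<^sup>t) U*\<close>. Such a decomposition of \<open>A\<close> exists
  exactly when \<open>A\<close> is positive definite; for other matrices the value is unspecified.
  The lemma \<open>mat_powr_eqI\<close> below shows that the value does not depend on the
  decomposition.
\<close>

definition mat_powr :: "complex^'n^'n \<Rightarrow> real \<Rightarrow> complex^'n^'n" where
  "mat_powr A t = (THE B. \<exists>U d. unitary_matrix U \<and> (\<forall>i. d i > 0) \<and>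
      A = U ** diag_matrix d ** conj_transpose U \<and>
      B = U ** diag_matrix (\<lambda>i. d i powr t) ** conj_transpose U)"

lemma diag_matrix_mult_left: "(diag_matrix d ** A) $ i $ j = complex_of_real (d i) * A $ i $ j"
  by (simp add: diag_matrix_def matrix_matrix_mult_def if_distrib[of "\<lambda>x. x * _"] cong: if_cong)

lemma diag_matrix_mult_right: "(A ** diag_matrix d) $ i $ j = A $ i $ j * complex_of_real (d j)"
  by (simp add: diag_matrix_def matrix_matrix_mult_def if_distrib[of "\<lambda>x. _ * x"] cong: if_cong)

lemma spectral_powr_unique:
  fixes U V :: "complex^'n^'n"
  assumes U: "unitary_matrix U" and V: "unitary_matrix V"
    and eq: "U ** diag_matrix d ** conj_transpose U = V ** diag_matrix e ** conj_transpose V"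
  shows "U ** diag_matrix (\<lambda>i. d i powr t) ** conj_transpose U =
         V ** diag_matrix (\<lambda>i. e i powr t) ** conj_transpose V"
proof -
  define W where "W = conj_transpose V ** U"
  have UU: "conj_transpose U ** U = mat 1" "U ** conj_transpose U = mat 1"
    and VV: "conj_transpose V ** V = mat 1" "V ** conj_transpose V = mat 1"
    using U V by (auto simp: unitary_matrix_def)
  have "conj_transpose V ** (U ** diag_matrix d ** conj_transpose U) ** U =
        conj_transpose V ** (V ** diag_matrix e ** conj_transpose V) ** U"
    by (simp only: eq)
  moreover have "conj_transpose V ** (U ** diag_matrix d ** conj_transpose U) ** U =
        conj_transpose V ** U ** diag_matrix d ** (conj_transpose U ** U)"
    by (simp only: matrix_mul_assoc)
  moreover have "conj_transpose V ** (V ** diag_matrix e ** conj_transpose V) ** U =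
        (conj_transpose V ** V) ** diag_matrix e ** (conj_transpose V ** U)"
    by (simp only: matrix_mul_assoc)
  ultimately have WD: "W ** diag_matrix d = diag_matrix e ** W"
    by (simp add: UU VV W_def)
  have ent: "W $ i $ j * complex_of_real (d j) = complex_of_real (e i) * W $ i $ j" for i j
    using WD by (metis diag_matrix_mult_left diag_matrix_mult_right)
  have "W $ i $ j * complex_of_real (d j powr t) = complex_of_real (e i powr t) * W $ i $ j" for i j
    using ent[of i j] by (cases "W $ i $ j = 0") auto
  hence WDt: "W ** diag_matrix (\<lambda>i. d i powr t) = diag_matrix (\<lambda>i. e i powr t) ** W"
    by (simp add: vec_eq_iff diag_matrix_mult_left diag_matrix_mult_right)
  have "V ** (W ** diag_matrix (\<lambda>i. d i powr t)) ** conj_transpose U =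
        (V ** conj_transpose V) ** U ** diag_matrix (\<lambda>i. d i powr t) ** conj_transpose U"
    by (simp only: W_def matrix_mul_assoc)
  moreover have "V ** (diag_matrix (\<lambda>i. e i powr t) ** W) ** conj_transpose U =
        V ** diag_matrix (\<lambda>i. e i powr t) ** conj_transpose V ** (U ** conj_transpose U)"
    by (simp only: W_def matrix_mul_assoc)
  ultimately show ?thesis
    using WDt by (simp add: UU VV)
qed

lemma mat_powr_eqI:
  fixes A :: "complex^'n^'n"
  assumes "unitary_matrix U" "\<And>i. d i > 0" "A = U ** diag_matrix d ** conj_transpose U"
  shows "mat_powr A t = U ** diag_matrix (\<lambda>i. d i powr t) ** conj_transpose U"
  unfolding mat_powr_def
proof (rule the_equality)
  show "\<exists>U' d'. unitary_matrix U' \<and> (\<forall>i. d' i > 0) \<and>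
      A = U' ** diag_matrix d' ** conj_transpose U' \<and>
      U ** diag_matrix (\<lambda>i. d i powr t) ** conj_transpose U =
      U' ** diag_matrix (\<lambda>i. d' i powr t) ** conj_transpose U'"
    using assms by blast
next
  fix B
  assume "\<exists>V e. unitary_matrix V \<and> (\<forall>i. e i > 0) \<and>
      A = V ** diag_matrix e ** conj_transpose V \<and>
      B = V ** diag_matrix (\<lambda>i. e i powr t) ** conj_transpose V"
  thus "B = U ** diag_matrix (\<lambda>i. d i powr t) ** conj_transpose U"
    using spectral_powr_unique[OF assms(1)] assms(3) by metis
qed

definition weighted_geometric_mean :: "complex^'n^'n \<Rightarrow> real \<Rightarrow> complex^'n^'n \<Rightarrow> complex^'n^'n"
    (\<open>(_ #\<^bsub>_\<^esub> _)\<close> [71, 0, 71] 70) where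
  "A #\<^bsub>t\<^esub> B = mat_powr A (1/2) **
      mat_powr (mat_powr A (-1/2) ** B ** mat_powr A (-1/2)) t ** mat_powr A (1/2)"

definition density_matrix :: "real^3 \<Rightarrow> complex^2^2" (\<open>\<rho>\<close>) where
  "\<rho> v = (1/2) *\<^sub>R vector
     [vector [1 + of_real (v $ 3), of_real (v $ 1) - \<i> * of_real (v $ 2)],
      vector [of_real (v $ 1) + \<i> * of_real (v $ 2), 1 - of_real (v $ 3)]]"

definition lorentz_factor :: "real^3 \<Rightarrow> real" (\<open>\<gamma>\<close>) where
  "\<gamma> v = 1 / sqrt (1 - (norm v)\<^sup>2)"

text \<open>
  The identity \<open>\<gamma> (u \<oplus>\<^sub>E (- v)) = \<gamma> u * \<gamma> v * (1 - u \<bullet> v)\<close> fixes the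
  normalisation of \<open>\<mu>\<close> in the theorem: with the factor \<open>\<gamma> u * \<gamma> v\<close>, its two values
  are the mutually inverse eigenvalues of \<open>(2 \<gamma>(u) \<rho>(u))\<^sup>-\<^sup>1 (2 \<gamma>(v) \<rho>(v))\<close>. The printed
  formula for \<open>\<mu>\<close> omits \<open>\<gamma> v\<close>; the identity then fails, for example at \<open>u = 0\<close>,
  \<open>v = (0, 0, 3/5)\<close>, \<open>t = 1/2\<close>.
\<close>

definition einstein_add :: "real^3 \<Rightarrow> real^3 \<Rightarrow> real^3" (infixl \<open>\<oplus>\<^sub>E\<close> 65) where
  "u \<oplus>\<^sub>E v = (1 / (1 + u \<bullet> v)) *\<^sub>R
     (u + (1 / \<gamma> u) *\<^sub>R v + (\<gamma> u / (1 + \<gamma> u) * (u \<bullet> v)) *\<^sub>R u)"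

text \<open>Meaningful for \<open>0 \<le> t \<le> 1\<close> and \<open>x > 0\<close>.\<close>

definition L :: "real \<Rightarrow> real \<Rightarrow> real" where
  "L t x = (if x = 1 then t else (x powr t - x powr (-t)) / (x - inverse x))"

end

theory Submission
  imports Defs
begin

text \<open>
  Put \<open>A = \<rho> u\<close>, \<open>B = \<rho> v\<close>, \<open>C = A\<^sup>-\<^sup>1\<^sup>/\<^sup>2 B A\<^sup>-\<^sup>1\<^sup>/\<^sup>2\<close> and \<open>k = \<gamma> u / \<gamma> v\<close>. Since \<open>det C = k\<^sup>2\<close> and
  \<open>tr C = tr (A\<^sup>-\<^sup>1 B) = 2 k \<gamma> u \<gamma> v (1 - u \<bullet> v) = k (\<mu> + 1/\<mu>)\<close>, the eigenvalues of the 2 by 2 matrix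
  \<open>C\<close> are \<open>k \<mu>\<close> and \<open>k / \<mu>\<close>. The affine function through the points \<open>(d, d\<^sup>t)\<close>, \<open>d\<close> an eigenvalue,
  has coefficients expressed by \<open>L\<close>, so \<open>C\<^sup>t\<close> is an explicit linear combination of \<open>1\<close> and \<open>C\<close>;
  multiplying by \<open>A\<^sup>1\<^sup>/\<^sup>2\<close> on both sides turns \<open>1\<close> into \<open>A\<close> and \<open>C\<close> into \<open>B\<close>.
\<close>

section \<open>Algebra of conjugate transposes, diagonal matrices and real scalars\<close>

lemma conj_transpose_mult:
  "conj_transpose (A ** B) = conj_transpose B ** conj_transpose A"
  by (simp add: conj_transpose_def matrix_matrix_mult_def vec_eq_iff mult.commute)

lemma conj_transpose_conj_transpose [simp]: "conj_transpose (conj_transpose A) = A"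
  by (simp add: conj_transpose_def vec_eq_iff)

lemma conj_transpose_diag_matrix [simp]: "conj_transpose (diag_matrix d) = diag_matrix d"
  by (simp add: conj_transpose_def diag_matrix_def vec_eq_iff)

lemma diag_matrix_mult: "diag_matrix d ** diag_matrix e = diag_matrix (\<lambda>i. d i * e i)"
  by (simp add: vec_eq_iff diag_matrix_mult_left) (simp add: diag_matrix_def)

lemma diag_matrix_one: "diag_matrix (\<lambda>i. 1) = mat 1"
  by (simp add: vec_eq_iff diag_matrix_def mat_def)

lemma matrix_add_rdistrib: "(A + B) ** C = A ** C + B ** C"
  for A B :: "complex^'n^'m" and C :: "complex^'l^'n"
  by (simp add: matrix_matrix_mult_def vec_eq_iff sum.distrib distrib_right)

lemma scaleR_matrix_mult_left: "(c *\<^sub>R A) ** B = c *\<^sub>R (A ** B)"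
  for A :: "complex^'n^'m" and B :: "complex^'l^'n"
  by (simp add: matrix_matrix_mult_def vec_eq_iff scaleR_sum_right)

lemma scaleR_matrix_mult_right: "A ** (c *\<^sub>R B) = c *\<^sub>R (A ** B)"
  for A :: "complex^'n^'m" and B :: "complex^'l^'n"
  by (simp add: matrix_matrix_mult_def vec_eq_iff scaleR_sum_right)

section \<open>Spectral decompositions and real powers\<close>

text \<open>Positive definiteness with its witnesses exposed, so that later arguments can work with
  the eigenvalues \<open>d i\<close> themselves.\<close>

definition spectral_decomp :: "complex^'n^'n \<Rightarrow> complex^'n^'n \<Rightarrow> ('n \<Rightarrow> real) \<Rightarrow> bool" where
  "spectral_decomp A U d \<longleftrightarrow>
     unitary_matrix U \<and> (\<forall>i. d i > 0) \<and> A = U ** diag_matrix d ** conj_transpose U"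

lemma mat_powr_spectral:
  "spectral_decomp A U d \<Longrightarrow>
     mat_powr A t = U ** diag_matrix (\<lambda>i. d i powr t) ** conj_transpose U"
  by (simp add: spectral_decomp_def mat_powr_eqI)

lemma conj_transpose_mat_powr:
  assumes "spectral_decomp A U d"
  shows "conj_transpose (mat_powr A t) = mat_powr A t"
  by (simp add: mat_powr_spectral[OF assms] conj_transpose_mult matrix_mul_assoc)

lemma mat_powr_mult:
  assumes "spectral_decomp A U d"
  shows "mat_powr A s ** mat_powr A t = mat_powr A (s + t)"
proof -
  have U: "conj_transpose U ** U = mat 1"
    using assms by (simp add: spectral_decomp_def unitary_matrix_def)
  have "mat_powr A s ** mat_powr A t =
      U ** diag_matrix (\<lambda>i. d i powr s) ** (conj_transpose U ** U) **
      diag_matrix (\<lambda>i. d i powr t) ** conj_transpose U"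
    by (simp only: mat_powr_spectral[OF assms] matrix_mul_assoc)
  also have "\<dots> = U ** (diag_matrix (\<lambda>i. d i powr s) ** diag_matrix (\<lambda>i. d i powr t)) **
      conj_transpose U"
    by (simp add: U matrix_mul_assoc)
  also have "\<dots> = mat_powr A (s + t)"
    by (simp add: mat_powr_spectral[OF assms] diag_matrix_mult powr_add)
  finally show ?thesis .
qed

lemma mat_powr_zero: "spectral_decomp A U d \<Longrightarrow> mat_powr A 0 = mat 1"
  by (auto simp: mat_powr_spectral spectral_decomp_def unitary_matrix_def diag_matrix_one
      less_imp_neq[symmetric])

lemma mat_powr_one: "spectral_decomp A U d \<Longrightarrow> mat_powr A 1 = A"
  by (simp add: mat_powr_spectral) (simp add: spectral_decomp_def less_imp_le)

text \<open>Functional calculus sees a function only through its values on the spectrum, so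
  \<open>f\<close> and \<open>g\<close> may depend on \<open>A\<close>: agreement at the eigenvalues
  suffices.\<close>

lemma mat_powr_affine:
  assumes A: "spectral_decomp A U d" and eq: "\<And>i. d i powr t = f + g * d i"
  shows "mat_powr A t = f *\<^sub>R mat 1 + g *\<^sub>R A"
proof -
  have "diag_matrix (\<lambda>i. d i powr t) = f *\<^sub>R mat 1 + g *\<^sub>R diag_matrix d"
    by (simp add: vec_eq_iff diag_matrix_def mat_def eq scaleR_conv_of_real[where 'a = complex])
  with A show ?thesis
    by (simp add: mat_powr_spectral[OF A] matrix_add_ldistrib matrix_add_rdistrib
        scaleR_matrix_mult_left scaleR_matrix_mult_right)
       (simp add: spectral_decomp_def unitary_matrix_def)
qed

lemma trace_spectral:
  assumes "spectral_decomp A U d"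
  shows "trace A = of_real (\<Sum>i\<in>UNIV. d i)"
proof -
  have "trace A = trace (conj_transpose U ** (U ** diag_matrix d))"
    using assms by (simp add: spectral_decomp_def trace_mul_sym[of "U ** diag_matrix d"])
  also have "\<dots> = trace (diag_matrix d :: complex^'a^'a)"
    using assms by (simp add: spectral_decomp_def unitary_matrix_def matrix_mul_assoc)
  finally show ?thesis by (simp add: trace_def diag_matrix_def)
qed

lemma det_spectral:
  assumes "spectral_decomp A U d"
  shows "det A = of_real (\<Prod>i\<in>UNIV. d i)"
proof -
  have "det A = det (conj_transpose U ** U) * det (diag_matrix d :: complex^'a^'a)"
    using assms by (simp add: spectral_decomp_def det_mul mult.commute mult.left_commute)
  also have "\<dots> = det (diag_matrix d :: complex^'a^'a)"
    using assms by (simp add: spectral_decomp_def unitary_matrix_def)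
  also have "\<dots> = of_real (\<Prod>i\<in>UNIV. d i)"
    by (subst det_diagonal) (auto simp: diag_matrix_def)
  finally show ?thesis .
qed

section \<open>Hermitian matrices of size two\<close>

text \<open>Trace and determinant are the sum and the product of the two eigenvalues, so Vieta's
  formulas give the characteristic equation.\<close>

lemma spectral_eigenvalue_root_2:
  fixes A :: "complex^2^2"
  assumes "spectral_decomp A U d" "trace A = of_real T" "det A = of_real D"
  shows "(d i)\<^sup>2 - T * d i + D = 0"
proof -
  have "T = d 1 + d 2"
    using trace_spectral[OF assms(1)] assms(2) unfolding UNIV_2 by (simp flip: of_real_add)
  moreover have "D = d 1 * d 2"
    using det_spectral[OF assms(1)] assms(3) unfolding UNIV_2 by (simp flip: of_real_mult)
  ultimately show ?thesis
    using exhaust_2[of i] by (auto simp: power2_eq_square algebra_simps)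
qed

lemma conj_transpose_mat_1 [simp]: "conj_transpose (mat 1) = mat 1"
  by (simp add: conj_transpose_def mat_def vec_eq_iff)

text \<open>In size two, positive trace and determinant force both eigenvalues to be positive; the
  eigenvectors are written down explicitly.\<close>

lemma spectral_decomp_exists_2:
  fixes A :: "complex^2^2"
  assumes herm: "conj_transpose A = A" and T: "trace A = of_real T" "T > 0"
    and D: "det A = of_real D" "D > 0"
  shows "\<exists>U d. spectral_decomp A U d"
proof -
  define a b c where "a = Re (A $ 1 $ 1)" and "b = A $ 1 $ 2" and "c = Re (A $ 2 $ 2)"
  have h: "cnj (A $ j $ i) = A $ i $ j" for i j
    using herm by (metis (no_types, lifting) conj_transpose_def vec_lambda_beta)
  have A11: "A $ 1 $ 1 = of_real a" and A22: "A $ 2 $ 2 = of_real c"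
    using h[of 1 1] h[of 2 2] by (auto simp: a_def c_def complex_eq_iff)
  have A12: "A $ 1 $ 2 = b" and A21: "A $ 2 $ 1 = cnj b"
    using h[of 1 2] by (auto simp: b_def)
  have Tac: "T = a + c"
    using T(1) by (simp add: trace_def sum_2 A11 A22 flip: of_real_add)
  have bb: "b * cnj b = of_real ((cmod b)\<^sup>2)" "cnj b * b = of_real ((cmod b)\<^sup>2)"
    by (simp_all only: complex_norm_square mult.commute)
  have "of_real D = (of_real (a * c - (cmod b)\<^sup>2) :: complex)"
    using D(1) by (simp add: det_2 A11 A22 A12 A21 bb)
  hence Dac: "D = a * c - (cmod b)\<^sup>2" by (simp only: of_real_eq_iff)
  \<comment> \<open>The product \<open>a * c\<close> is at least \<open>D\<close>, so
    \<open>a\<close> and \<open>c\<close> have the same sign, and their sum \<open>T\<close> is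
    positive.\<close>
  have "a * c > 0"
    using Dac D(2) by (smt (verit) zero_le_power2)
  hence pos: "a > 0" "c > 0"
    using Tac T(2) by (auto simp: zero_less_mult_iff)
  show ?thesis
  \<comment> \<open>The diagonal case is separate because the eigenvector \<open>(b, p)\<close> used
    otherwise vanishes when \<open>b = 0\<close> and \<open>a \<ge> c\<close>.\<close>
  proof (cases "b = 0")
    case True
    define d :: "2 \<Rightarrow> real" where "d i = (if i = 1 then a else c)" for i
    have "A = diag_matrix d"
      by (simp add: vec_eq_iff forall_2 diag_matrix_def d_def A11 A12 A21 A22 True)
    hence "spectral_decomp A (mat 1) d"
      using pos by (simp add: spectral_decomp_def unitary_matrix_def d_def)
    thus ?thesis by blast
  next
    case False
    \<comment> \<open>\<open>e\<close> is the larger root of \<open>x^2 - (a + c) * x + D\<close>.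
      The first row of \<open>A - e\<close> annihilates \<open>(b, p)\<close>, the second does so by
      \<open>root\<close>, the characteristic equation; \<open>n\<close> is the length of this
      vector.\<close>
    define r where "r = sqrt (((a - c) / 2)\<^sup>2 + (cmod b)\<^sup>2)"
    define e where "e = (a + c) / 2 + r"
    define p where "p = e - a"
    define n where "n = sqrt ((cmod b)\<^sup>2 + p\<^sup>2)"
    have r2: "r\<^sup>2 = ((a - c) / 2)\<^sup>2 + (cmod b)\<^sup>2" by (simp add: r_def)
    have r0: "r \<ge> 0" by (simp add: r_def)
    have root: "p * (e - c) = (cmod b)\<^sup>2"
      using r2 by (simp add: p_def e_def power2_eq_square field_simps)
    have e0: "e > 0" using pos r0 by (simp add: e_def add_pos_nonneg)
    \<comment> \<open>The other eigenvalue is positive because the product of both is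
      \<open>D\<close>.\<close>
    have "e * (a + c - e) = D"
      using root Dac by (simp add: p_def algebra_simps)
    hence e1: "a + c - e > 0" using e0 D(2) by (metis zero_less_mult_pos)
    have npos: "(cmod b)\<^sup>2 + p\<^sup>2 > 0" using False by (simp add: add_pos_nonneg)
    hence n0: "n > 0" by (simp add: n_def)
    have n2: "n\<^sup>2 = (cmod b)\<^sup>2 + p\<^sup>2" using npos by (simp add: n_def)
    have nn: "complex_of_real n * of_real n = of_real ((cmod b)\<^sup>2) + of_real p * of_real p"
      using n2 by (simp add: power2_eq_square flip: of_real_mult of_real_add)
    have n0': "complex_of_real n \<noteq> 0" using n0 by simp
    define d :: "2 \<Rightarrow> real" where "d i = (if i = 1 then e else a + c - e)" for i
    \<comment> \<open>Normalised eigenvectors for the eigenvalues \<open>e\<close> and \<open>a + c - e\<close>, as columns.\<close>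
    define U :: "complex^2^2" where
      "U = vector [vector [b / of_real n, of_real p / of_real n],
                   vector [of_real p / of_real n, - cnj b / of_real n]]"
    have nz: "complex_of_real ((cmod b)\<^sup>2) + of_real p * of_real p \<noteq> 0"
      using nn n0' by (metis mult_eq_0_iff)
    have U: "U $ 1 $ 1 = b / of_real n" "U $ 1 $ 2 = of_real p / of_real n"
      "U $ 2 $ 1 = of_real p / of_real n" "U $ 2 $ 2 = - cnj b / of_real n"
      by (simp_all add: U_def vector_2)
    have "unitary_matrix U"
      using nn nz bb
      by (simp add: unitary_matrix_def vec_eq_iff forall_2 matrix_matrix_mult_def sum_2
          conj_transpose_def mat_def U add_divide_distrib[symmetric] add.commute mult.commute)
    moreover have "U ** diag_matrix d ** conj_transpose U = A"
    proof -
      have ent: "(U ** diag_matrix d ** conj_transpose U) $ i $ j =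
        U $ i $ 1 * of_real e * cnj (U $ j $ 1) + U $ i $ 2 * of_real (a + c - e) * cnj (U $ j $ 2)" for i j
        by (subst matrix_matrix_mult_def)
          (simp add: diag_matrix_mult_right sum_2 conj_transpose_def d_def)
      \<comment> \<open>After clearing the denominator \<open>n^2\<close>, these are the diagonal
        entries and the common factor of the off-diagonal ones. Replacing \<open>(cmod b)^2\<close>
        by \<open>p * (e - c)\<close> leaves polynomial identities.\<close>
      have q: "(cmod b)\<^sup>2 * e + p\<^sup>2 * (a + c - e) = a * n\<^sup>2"
        "p\<^sup>2 * e + (cmod b)\<^sup>2 * (a + c - e) = c * n\<^sup>2"
        "p * e - p * (a + c - e) = n\<^sup>2"
        unfolding n2 root[symmetric] by (simp_all add: p_def power2_eq_square algebra_simps)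
      have q': "of_real ((cmod b)\<^sup>2) * of_real e + of_real p * of_real p * of_real (a + c - e)
          = complex_of_real a * (of_real n * of_real n)"
        "of_real p * of_real p * of_real e + of_real ((cmod b)\<^sup>2) * of_real (a + c - e)
          = complex_of_real c * (of_real n * of_real n)"
        "of_real p * of_real e - of_real p * of_real (a + c - e)
          = complex_of_real n * of_real n"
        using q unfolding power2_eq_square
        by (simp_all only: of_real_mult[symmetric] of_real_add[symmetric] of_real_diff[symmetric])
      have "(U ** diag_matrix d ** conj_transpose U) $ 1 $ 1 =
        ((b * cnj b) * of_real e + of_real p * of_real p * of_real (a + c - e)) / (of_real n * of_real n)"
        by (simp add: ent U add_divide_distrib mult_ac)
      moreover have "(U ** diag_matrix d ** conj_transpose U) $ 2 $ 2 =
        (of_real p * of_real p * of_real e + (b * cnj b) * of_real (a + c - e)) / (of_real n * of_real n)"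
        by (simp add: ent U add_divide_distrib mult_ac)
      moreover have "(U ** diag_matrix d ** conj_transpose U) $ 1 $ 2 =
        b * (of_real p * of_real e - of_real p * of_real (a + c - e)) / (of_real n * of_real n)"
        by (simp add: ent U add_divide_distrib diff_divide_distrib algebra_simps)
      moreover have "(U ** diag_matrix d ** conj_transpose U) $ 2 $ 1 =
        cnj b * (of_real p * of_real e - of_real p * of_real (a + c - e)) / (of_real n * of_real n)"
        by (simp add: ent U add_divide_distrib diff_divide_distrib algebra_simps)
      ultimately show ?thesis
        using n0' by (simp only: vec_eq_iff forall_2 A11 A12 A21 A22 bb q') simp
    qed
    ultimately have "spectral_decomp A U d"
      using e0 e1 by (simp add: spectral_decomp_def d_def)
    thus ?thesis by blast
  qed
qed

text \<open>\<open>M\<close> is the inverse of \<open>A\<close>, so \<open>det A\<close> times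
  \<open>M\<close> is the adjugate of \<open>A\<close>. This computes the trace of a product with an
  inverse from the entries of \<open>A\<close> and \<open>B\<close> alone.\<close>

lemma trace_adjugate_2:
  fixes A M B :: "complex^2^2"
  assumes "M ** A = mat 1"
  shows "det A * trace (M ** B) =
    A $ 2 $ 2 * B $ 1 $ 1 - A $ 1 $ 2 * B $ 2 $ 1 - A $ 2 $ 1 * B $ 1 $ 2 + A $ 1 $ 1 * B $ 2 $ 2"
proof -
  define adj :: "complex^2^2" where
    "adj = vector [vector [A $ 2 $ 2, - A $ 1 $ 2], vector [- A $ 2 $ 1, A $ 1 $ 1]]"
  have "A ** adj = mat (det A)"
    by (simp add: adj_def vec_eq_iff forall_2 matrix_matrix_mult_def sum_2 mat_def det_2 vector_2
        algebra_simps)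
  moreover have "M ** A ** adj = M ** (A ** adj)" by (simp add: matrix_mul_assoc)
  ultimately have "adj = M ** mat (det A)" using assms by simp
  hence "adj ** B = M ** (mat (det A) ** B)" by (simp add: matrix_mul_assoc)
  hence "trace (adj ** B) = det A * trace (M ** B)"
    by (simp add: trace_def matrix_matrix_mult_def sum_2 mat_def algebra_simps)
  moreover have "trace (adj ** B) =
    A $ 2 $ 2 * B $ 1 $ 1 - A $ 1 $ 2 * B $ 2 $ 1 - A $ 2 $ 1 * B $ 1 $ 2 + A $ 1 $ 1 * B $ 2 $ 2"
    by (simp add: adj_def trace_def matrix_matrix_mult_def sum_2 vector_2)
  ultimately show ?thesis by simp
qed

section \<open>Trace, determinant and mixed determinant of density matrices\<close>

lemma density_matrix_nth:
  "\<rho> v $ 1 $ 1 = (1 + of_real (v $ 3)) / 2"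
  "\<rho> v $ 1 $ 2 = (of_real (v $ 1) - \<i> * of_real (v $ 2)) / 2"
  "\<rho> v $ 2 $ 1 = (of_real (v $ 1) + \<i> * of_real (v $ 2)) / 2"
  "\<rho> v $ 2 $ 2 = (1 - of_real (v $ 3)) / 2"
  by (simp_all add: density_matrix_def vector_2 scaleR_conv_of_real[where 'a = complex])

lemma conj_transpose_density_matrix: "conj_transpose (\<rho> v) = \<rho> v"
  by (simp add: vec_eq_iff forall_2 conj_transpose_def density_matrix_nth)

lemma trace_density_matrix: "trace (\<rho> v) = 1"
  by (simp add: trace_def sum_2 density_matrix_nth field_simps)

lemma det_density_matrix: "det (\<rho> v) = of_real ((1 - (norm v)\<^sup>2) / 4)"
  by (simp add: det_2 density_matrix_nth power2_norm_eq_inner inner_vec_def sum_3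
      power2_eq_square[symmetric] complex_eq_iff field_simps)

text \<open>The polarised determinant: for \<open>u = v\<close> both sides are twice
  \<open>det (\<rho> u)\<close>. It is the right-hand side of
  \<open>trace_adjugate_2\<close>.\<close>

lemma trace_adjugate_density_matrix:
  "\<rho> u $ 2 $ 2 * \<rho> v $ 1 $ 1 - \<rho> u $ 1 $ 2 * \<rho> v $ 2 $ 1 - \<rho> u $ 2 $ 1 * \<rho> v $ 1 $ 2 +
     \<rho> u $ 1 $ 1 * \<rho> v $ 2 $ 2 = of_real ((1 - u \<bullet> v) / 2)"
  by (simp add: density_matrix_nth inner_vec_def sum_3 complex_eq_iff field_simps)

section \<open>Lorentz factor of an Einstein sum\<close>

text \<open>The identity \<open>\<gamma> (u \<oplus>\<^sub>E v) = \<gamma> u * \<gamma> v * (1 + u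
  \<bullet> v)\<close> in squared, reciprocal form, which avoids square roots.\<close>

lemma norm_sq_einstein_add:
  assumes u: "norm u < 1" and v: "norm v < 1"
  shows "1 - (norm (u \<oplus>\<^sub>E v))\<^sup>2 = (1 - (norm u)\<^sup>2) * (1 - (norm v)\<^sup>2) / (1 + u \<bullet> v)\<^sup>2"
proof -
  define s c where "s = sqrt (1 - (norm u)\<^sup>2)" and "c = u \<bullet> v"
  have s0: "s > 0" using u by (simp add: s_def abs_square_less_1)
  have s2: "s\<^sup>2 = 1 - (norm u)\<^sup>2" using u by (simp add: s_def abs_square_le_1)
  have "\<bar>c\<bar> \<le> norm u * norm v" by (simp add: c_def Cauchy_Schwarz_ineq2)
  also have "\<dots> < 1" using u v by (metis mult_strict_mono' mult_1 norm_ge_zero)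
  finally have c: "1 + c > 0" by linarith
  have g: "\<gamma> u = 1 / s" by (simp add: lorentz_factor_def s_def)
  have coef: "\<gamma> u / (1 + \<gamma> u) = 1 / (1 + s)" using s0 by (simp add: g field_simps)
  \<comment> \<open>The coefficient of \<open>u\<close> in the sum, once the prefactor
    \<open>1 / (1 + c)\<close> is taken out.\<close>
  define k where "k = (1 + s + c) / (1 + s)"
  have k: "k * (1 + s) = 1 + s + c" using s0 by (simp add: k_def)
  have k': "k = 1 + c / (1 + s)" using s0 by (simp add: k_def field_simps)
  have "u \<oplus>\<^sub>E v = (1 / (1 + c)) *\<^sub>R (k *\<^sub>R u + s *\<^sub>R v)"
    unfolding einstein_add_def coef by (simp add: g k' scaleR_add_left add_ac flip: c_def)
  hence "(norm (u \<oplus>\<^sub>E v))\<^sup>2 = (norm (k *\<^sub>R u + s *\<^sub>R v))\<^sup>2 / (1 + c)\<^sup>2"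
    using c by (simp add: power_divide)
  also have "(norm (k *\<^sub>R u + s *\<^sub>R v))\<^sup>2 = k\<^sup>2 * (norm u)\<^sup>2 + 2 * s * k * c + s\<^sup>2 * (norm v)\<^sup>2"
    unfolding power2_norm_eq_inner
    by (simp add: inner_simps c_def inner_commute power2_eq_square algebra_simps)
  also have "(norm u)\<^sup>2 = 1 - s\<^sup>2" using s2 by simp
  also have "k\<^sup>2 * (1 - s\<^sup>2) + 2 * s * k * c + s\<^sup>2 * (norm v)\<^sup>2 =
      (1 + c)\<^sup>2 - s\<^sup>2 * (1 - (norm v)\<^sup>2)"
  proof -
    \<comment> \<open>Splitting \<open>1 - s^2\<close> as \<open>(1 + s) * (1 - s)\<close> lets each
      factor \<open>k\<close> meet a factor \<open>1 + s\<close>, which cancels its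
      denominator.\<close>
    have "k\<^sup>2 * (1 - s\<^sup>2) + 2 * s * k * c = k * ((k * (1 + s)) * (1 - s) + 2 * s * c)"
      by (simp add: power2_eq_square algebra_simps)
    also have "\<dots> = k * ((1 + s) * (1 + c - s))"
      unfolding k by (simp add: algebra_simps)
    also have "\<dots> = k * (1 + s) * (1 + c - s)" by (simp only: mult.assoc)
    also have "\<dots> = (1 + c)\<^sup>2 - s\<^sup>2"
      by (simp only: k) (simp add: power2_eq_square algebra_simps)
    finally show ?thesis by (simp add: algebra_simps)
  qed
  finally show ?thesis
    using c s2 by (simp add: c_def diff_divide_distrib)
qed

section \<open>The function \<open>L\<close> as an interpolation coefficient\<close>

text \<open>Numerator and denominator both change sign. Hence the same coefficients serve the two
  reciprocal points \<open>x\<close> and \<open>inverse x\<close>.\<close>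

lemma L_inverse:
  assumes "x > 0"
  shows "L t (inverse x) = L t x"
proof -
  have "inverse x powr s = x powr (-s)" for s
    using assms by (simp add: inverse_powr powr_minus)
  thus ?thesis
    by (simp add: L_def) (metis minus_diff_eq minus_divide_divide)
qed

text \<open>Together with \<open>L_inverse\<close>, the line with intercept
  \<open>L (1 - t) x\<close> and slope \<open>L t x\<close> meets the graph of the power
  \<open>t\<close> at \<open>x\<close> and at \<open>inverse x\<close>; for \<open>x = 1\<close> it
  is the tangent there.\<close>

lemma L_interpolates_powr:
  assumes x: "x > 0"
  shows "L (1 - t) x + L t x * x = x powr t"
proof (cases "x = 1")
  case False
  have 0: "x - inverse x \<noteq> 0"
    using False x by (smt (verit) inverse_less_1_iff one_less_inverse_iff)
  \<comment> \<open>In the combined numerator the two terms \<open>x * x powr (-t)\<close>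
    cancel.\<close>
  have "x powr (1 - t) = x * x powr (-t)" "x powr (- (1 - t)) = inverse x * x powr t"
    using x by (simp_all add: powr_diff powr_minus divide_simps)
  hence "L (1 - t) x + L t x * x = (x powr t * (x - inverse x)) / (x - inverse x)"
    using False by (simp add: L_def add_divide_distrib[symmetric] algebra_simps)
  with 0 show ?thesis by simp
qed (simp add: L_def)

section \<open>The geometric mean of two density matrices\<close>

theorem proposition5p10:
  fixes u v :: "real^3" and t \<mu> :: real
  assumes "u \<in> ball 0 1" and "v \<in> ball 0 1" and "t \<in> {0..1}"
    and "\<mu> = \<gamma> u * \<gamma> v * (1 - u \<bullet> v) * (1 + norm (u \<oplus>\<^sub>E (- v))) \<or>
         \<mu> = \<gamma> u * \<gamma> v * (1 - u \<bullet> v) * (1 - norm (u \<oplus>\<^sub>E (- v)))"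
  shows "\<rho> u #\<^bsub>t\<^esub> \<rho> v =
           (L (1 - t) \<mu> * (\<gamma> u / \<gamma> v) powr t) *\<^sub>R \<rho> u +
           (L t \<mu> * (\<gamma> v / \<gamma> u) powr (1 - t)) *\<^sub>R \<rho> v"
proof -
  have u: "norm u < 1" and v: "norm v < 1" using assms(1,2) by simp_all
  \<comment> \<open>\<open>G\<close> is the Lorentz factor of
    \<open>u \<oplus>\<^sub>E (- v)\<close>, and \<open>k\<close> will be the geometric mean of the
    eigenvalues of \<open>C\<close>.\<close>
  define N G k where "N = norm (u \<oplus>\<^sub>E (- v))" and "G = \<gamma> u * \<gamma> v * (1 - u \<bullet> v)"
    and "k = \<gamma> u / \<gamma> v"
  have u2: "1 - (norm u)\<^sup>2 > 0" and v2: "1 - (norm v)\<^sup>2 > 0"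
    using u v by (simp_all add: abs_square_less_1)
  have gu: "\<gamma> u > 0" "(1 - (norm u)\<^sup>2) * (\<gamma> u)\<^sup>2 = 1" and gv: "\<gamma> v > 0" "(1 - (norm v)\<^sup>2) * (\<gamma> v)\<^sup>2 = 1"
    using u2 v2 by (simp_all add: lorentz_factor_def power_divide)
  have "\<bar>u \<bullet> v\<bar> \<le> norm u * norm v" by (simp add: Cauchy_Schwarz_ineq2)
  also have "\<dots> < 1" using u v by (metis mult_strict_mono' mult_1 norm_ge_zero)
  finally have uv: "1 - u \<bullet> v > 0" by linarith
  have k0: "k > 0" using gu gv by (simp add: k_def)
  have G0: "G > 0" using gu gv uv by (simp add: G_def)

  have "1 - N\<^sup>2 = (1 - (norm u)\<^sup>2) * (1 - (norm v)\<^sup>2) / (1 - u \<bullet> v)\<^sup>2"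
    using norm_sq_einstein_add[of u "- v"] u v by (simp add: N_def)
  hence "G\<^sup>2 * (1 - N\<^sup>2) = ((1 - (norm u)\<^sup>2) * (\<gamma> u)\<^sup>2) * ((1 - (norm v)\<^sup>2) * (\<gamma> v)\<^sup>2)"
    using uv by (simp add: G_def power_mult_distrib)
  also have "\<dots> = 1" by (simp only: gu gv)
  finally have GN: "(G * (1 + N)) * (G * (1 - N)) = 1"
    by (simp add: power2_eq_square algebra_simps)
  have "N \<ge> 0" by (simp add: N_def)
  hence "G * (1 + N) > 0" using G0 by simp
  moreover from this GN have "G * (1 - N) > 0" by (metis zero_less_mult_pos zero_less_one)
  moreover have "inverse (G * (1 + N)) = G * (1 - N)" "inverse (G * (1 - N)) = G * (1 + N)"
    using GN by (auto intro: inverse_unique simp only: mult.commute)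
  moreover have "\<mu> = G * (1 + N) \<or> \<mu> = G * (1 - N)"
    using assms(4) by (simp add: G_def N_def)
  \<comment> \<open>The two candidates for \<open>\<mu>\<close> are reciprocal with sum
    \<open>2 * G\<close>, so either sign gives these facts, and the rest of the proof treats both
    signs at once.\<close>
  ultimately have \<mu>: "\<mu> > 0" "\<mu> + inverse \<mu> = 2 * G"
    by (auto simp only:) (simp_all add: algebra_simps)

  obtain U d where A: "spectral_decomp (\<rho> u) U d"
    using spectral_decomp_exists_2[OF conj_transpose_density_matrix, where T = 1]
      det_density_matrix[of u] u2 by (fastforce simp: trace_density_matrix)
  define S R C where "S = mat_powr (\<rho> u) (1/2)" and "R = mat_powr (\<rho> u) (-1/2)"
    and "C = R ** \<rho> v ** R"
  have SS: "S ** S = \<rho> u" and SR: "S ** R = mat 1" and RS: "R ** S = mat 1"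
    using mat_powr_mult[OF A] mat_powr_one[OF A] mat_powr_zero[OF A] by (simp_all add: S_def R_def)
  have RR: "(R ** R) ** \<rho> u = mat 1"
  proof -
    have "(R ** R) ** \<rho> u = R ** (R ** S) ** S"
      by (simp only: SS[symmetric] matrix_mul_assoc)
    thus ?thesis by (simp add: RS)
  qed
  have SCS: "S ** C ** S = \<rho> v"
  proof -
    have "S ** C ** S = (S ** R) ** \<rho> v ** (R ** S)"
      by (simp only: C_def matrix_mul_assoc)
    thus ?thesis by (simp add: SR RS)
  qed
  have herm: "conj_transpose C = C"
    by (simp add: C_def R_def conj_transpose_mult conj_transpose_mat_powr[OF A]
        conj_transpose_density_matrix matrix_mul_assoc)
  have kk: "(1 - (norm v)\<^sup>2) = k\<^sup>2 * (1 - (norm u)\<^sup>2)"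
    using gu gv by (simp add: k_def field_simps)
  have ru: "det (\<rho> u) \<noteq> 0" using u2 by (simp add: det_density_matrix del: of_real_diff)
  have detC: "det C = of_real (k\<^sup>2)"
  proof -
    have "det S * det C * det S = det (\<rho> v)" by (simp add: SCS[symmetric] det_mul)
    moreover have "det S * det S = det (\<rho> u)" by (simp add: SS[symmetric] det_mul)
    ultimately have "det (\<rho> u) * det C = det (\<rho> v)" by (simp add: algebra_simps)
    also have "\<dots> = det (\<rho> u) * of_real (k\<^sup>2)" by (simp add: det_density_matrix kk)
    finally show ?thesis using ru by simp
  qed
  have trC: "trace C = of_real (k * (\<mu> + inverse \<mu>))"
  proof -
    \<comment> \<open>Cyclicity of the trace brings the two factors \<open>R\<close> together as the
      inverse of \<open>\<rho> u\<close>, where the adjugate formula applies.\<close>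
    have "trace C = trace ((R ** R) ** \<rho> v)"
      by (simp add: C_def trace_mul_sym[of "R ** \<rho> v"] matrix_mul_assoc)
    hence "det (\<rho> u) * trace C = of_real ((1 - u \<bullet> v) / 2)"
      using trace_adjugate_2[OF RR, of "\<rho> v"] trace_adjugate_density_matrix[of u v] by simp
    also have "(1 - u \<bullet> v) / 2 = (1 - (norm u)\<^sup>2) / 4 * (2 * (k * G))"
    proof -
      have "k * G = (\<gamma> u)\<^sup>2 * (1 - u \<bullet> v)"
        using gv by (simp add: k_def G_def power2_eq_square)
      hence "(1 - (norm u)\<^sup>2) / 4 * (2 * (k * G)) =
          ((1 - (norm u)\<^sup>2) * (\<gamma> u)\<^sup>2) * (1 - u \<bullet> v) / 2" by simp
      thus ?thesis by (simp only: gu)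
    qed
    finally have "det (\<rho> u) * trace C = det (\<rho> u) * of_real (k * (\<mu> + inverse \<mu>))"
      by (simp only: det_density_matrix \<mu>(2) of_real_mult mult_ac)
    thus ?thesis using ru by simp
  qed
  obtain V e where C: "spectral_decomp C V e"
    using spectral_decomp_exists_2[OF herm trC _ detC] k0 \<mu>(1) by (auto simp: add_pos_pos)

  \<comment> \<open>The interpolation at \<open>\<mu>\<close> and \<open>inverse \<mu>\<close> is
    rescaled by \<open>k\<close>: values scale by \<open>k powr t\<close>, and the slope loses one
    factor \<open>k\<close>, hence the exponent \<open>t - 1\<close> in \<open>g'\<close>.\<close>
  define f g where "f = L (1 - t) \<mu> * k powr t" and "g = L t \<mu> * (\<gamma> v / \<gamma> u) powr (1 - t)"
  have g': "g = L t \<mu> * k powr (t - 1)"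
  proof -
    have "\<gamma> v / \<gamma> u = inverse k" by (simp add: k_def)
    thus ?thesis using k0 by (simp add: g_def inverse_powr powr_minus[symmetric])
  qed
  have pow: "(k * x) powr t = f + g * (k * x)" if x: "x = \<mu> \<or> x = inverse \<mu>" for x
  proof -
    have x0: "x > 0" and Lx: "L s x = L s \<mu>" for s
      using x \<mu>(1) by (auto simp: L_inverse)
    have "(k * x) powr t = k powr t * (L (1 - t) \<mu> + L t \<mu> * x)"
      using x0 k0 L_interpolates_powr[OF x0, of t] by (simp add: Lx powr_mult)
    also have "\<dots> = f + g * (k * x)"
      using k0 by (simp add: f_def g' powr_diff algebra_simps)
    finally show ?thesis .
  qed
  have "e i powr t = f + g * e i" for i
  proof -
    \<comment> \<open>The characteristic polynomial of \<open>C\<close> factors. Each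
      \<open>e i\<close> is thus one of the two nodes, and it does not matter which.\<close>
    have "(e i - k * \<mu>) * (e i - k * inverse \<mu>) =
        (e i)\<^sup>2 - k * (\<mu> + inverse \<mu>) * e i + k\<^sup>2 * (\<mu> * inverse \<mu>)"
      by (simp add: power2_eq_square algebra_simps)
    also have "\<dots> = 0"
      using spectral_eigenvalue_root_2[OF C trC detC, of i] \<mu>(1) by simp
    finally have "(e i - k * \<mu>) * (e i - k * inverse \<mu>) = 0" .
    hence "e i = k * \<mu> \<or> e i = k * inverse \<mu>" by simp
    thus ?thesis using pow by metis
  qed
  hence Ct: "mat_powr C t = f *\<^sub>R mat 1 + g *\<^sub>R C"
    by (rule mat_powr_affine[OF C])
  have "\<rho> u #\<^bsub>t\<^esub> \<rho> v = S ** mat_powr C t ** S"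
    by (simp add: weighted_geometric_mean_def S_def C_def R_def)
  also have "\<dots> = f *\<^sub>R \<rho> u + g *\<^sub>R \<rho> v"
    by (simp add: Ct matrix_add_ldistrib matrix_add_rdistrib scaleR_matrix_mult_left
        scaleR_matrix_mult_right SS SCS)
  finally show ?thesis by (simp add: f_def g_def k_def)
qed

end
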